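(* There exist two finite nilpotent groups of nilpotency class $3$ whose commuting graphs are isomorphic but which are not isoclinic.
   Context: The commuting graph of a finite group $G$ is the simple undirected graph with vertex set $G$ (all elements) in which distinct $x,y\in G$ are adjacent iff $xy=yx$. For a group $G$ with centre $Z=Z(G)$ and derived subgroup $G'$, the commutator map is $\kappa: G/Z\times G/Z\to G'$, $(Za,Zb)\mapsto aba^{-1}b^{-1}$. Two groups $G_1,G_2$ with centres $Z_1,Z_2$ are isoclinic if there are isomorphisms $G_1/Z_1\to G_2/Z_2$ and $G_1'\to G_2'$ that commute with the commutator maps of $G_1$ and $G_2$. *)

theory Defs
  imports
    "HOL-Algebra.Generated_Groups"
    "Graph_Theory.Pair_Digraph"
    "Graph_Theory.Digraph_Isomorphism"
begin

definition commutator :: "('a, 'b) monoid_scheme \<Rightarrow> 'a \<Rightarrow> 'a \<Rightarrow> 'a" where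
  "commutator G a b = a \<otimes>\<^bsub>G\<^esub> b \<otimes>\<^bsub>G\<^esub> inv\<^bsub>G\<^esub> a \<otimes>\<^bsub>G\<^esub> inv\<^bsub>G\<^esub> b"

definition centre :: "('a, 'b) monoid_scheme \<Rightarrow> 'a set" where
  "centre G = {z \<in> carrier G. \<forall>x \<in> carrier G. z \<otimes>\<^bsub>G\<^esub> x = x \<otimes>\<^bsub>G\<^esub> z}"

text \<open>The lower central series, indexed from 0: the term \<open>lower_central_series G n\<close> is what is
  usually written \<open>\<gamma>\<close> with index \<open>n + 1\<close>, so that a nilpotent group has class \<open>c\<close> iff \<open>c\<close> is the
  least index of a trivial term.\<close>

primrec lower_central_series :: "('a, 'b) monoid_scheme \<Rightarrow> nat \<Rightarrow> 'a set" where
  "lower_central_series G 0 = carrier G"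
| "lower_central_series G (Suc n) =
     generate G {commutator G a b | a b. a \<in> lower_central_series G n \<and> b \<in> carrier G}"

definition nilpotent_group :: "('a, 'b) monoid_scheme \<Rightarrow> bool" where
  "nilpotent_group G \<longleftrightarrow> group G \<and> (\<exists>n. lower_central_series G n = {\<one>\<^bsub>G\<^esub>})"

text \<open>Meaningful only for nilpotent groups.\<close>

definition nilpotency_class :: "('a, 'b) monoid_scheme \<Rightarrow> nat" where
  "nilpotency_class G = (LEAST n. lower_central_series G n = {\<one>\<^bsub>G\<^esub>})"

text \<open>A simple undirected graph is represented as a symmetric loop-free digraph whose arcs are pairs
  of vertices: the edge between \<open>x\<close> and \<open>y\<close> is the pair of arcs \<open>(x, y)\<close> and \<open>(y, x)\<close>.\<close>

definition commuting_graph :: "('a, 'b) monoid_scheme \<Rightarrow> 'a pair_pre_digraph" where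
  "commuting_graph G =
     \<lparr> pverts = carrier G,
       parcs = {(x, y). x \<in> carrier G \<and> y \<in> carrier G \<and> x \<noteq> y \<and> x \<otimes>\<^bsub>G\<^esub> y = y \<otimes>\<^bsub>G\<^esub> x} \<rparr>"

lemma pair_graph_commuting_graph:
  assumes "finite (carrier G)"
  shows "pair_graph (commuting_graph G)"
proof -
  have "finite (parcs (commuting_graph G))"
    by (rule finite_subset[of _ "carrier G \<times> carrier G"])
       (use assms in \<open>auto simp: commuting_graph_def\<close>)
  then show ?thesis
    using assms by unfold_locales (auto simp: commuting_graph_def symmetric_def arcs_ends_def
        arc_to_ends_def sym_def)
qed

lemma digraph_iso_commuting_graph_iff:
  "digraph_iso (with_proj (commuting_graph G)) (with_proj (commuting_graph H)) \<longleftrightarrow>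
    (\<exists>f. bij_betw f (carrier G) (carrier H) \<and>
      (\<forall>x \<in> carrier G. \<forall>y \<in> carrier G. x \<noteq> y \<longrightarrow>
        (x \<otimes>\<^bsub>G\<^esub> y = y \<otimes>\<^bsub>G\<^esub> x \<longleftrightarrow> f x \<otimes>\<^bsub>H\<^esub> f y = f y \<otimes>\<^bsub>H\<^esub> f x)))"
  (is "?L \<longleftrightarrow> ?R")
proof
  assume ?L
  then obtain h where h: "pre_digraph.digraph_isomorphism (with_proj (commuting_graph G)) h"
    and eq: "with_proj (commuting_graph H) = app_iso h (with_proj (commuting_graph G))"
    unfolding digraph_iso_def by blast
  let ?f = "iso_verts h"
  have inj: "inj_on ?f (carrier G)"
    using h by (simp add: pre_digraph.digraph_isomorphism_def commuting_graph_def)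
  have V: "carrier H = ?f ` carrier G"
    using arg_cong[OF eq, of verts] by (simp add: commuting_graph_def)
  have t: "iso_tail h = fst" and d: "iso_head h = snd"
    using arg_cong[OF eq, of tail] arg_cong[OF eq, of head] by simp_all
  have a: "iso_arcs h e = (?f (fst e), ?f (snd e))" if "e \<in> parcs (commuting_graph G)" for e
    using h that unfolding pre_digraph.digraph_isomorphism_def t d by (simp add: prod_eq_iff)
  have "parcs (commuting_graph H) = iso_arcs h ` parcs (commuting_graph G)"
    using arg_cong[OF eq, of arcs] by simp
  also have "\<dots> = (\<lambda>e. (?f (fst e), ?f (snd e))) ` parcs (commuting_graph G)"
    by (rule image_cong) (simp_all add: a)
  finally have A: "parcs (commuting_graph H) =
    (\<lambda>e. (?f (fst e), ?f (snd e))) ` parcs (commuting_graph G)" .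
  have "x \<otimes>\<^bsub>G\<^esub> y = y \<otimes>\<^bsub>G\<^esub> x \<longleftrightarrow> ?f x \<otimes>\<^bsub>H\<^esub> ?f y = ?f y \<otimes>\<^bsub>H\<^esub> ?f x"
    if x: "x \<in> carrier G" and y: "y \<in> carrier G" and ne: "x \<noteq> y" for x y
  proof -
    have "?f x \<noteq> ?f y" using inj x y ne by (auto dest: inj_onD)
    then have "?f x \<otimes>\<^bsub>H\<^esub> ?f y = ?f y \<otimes>\<^bsub>H\<^esub> ?f x \<longleftrightarrow> (?f x, ?f y) \<in> parcs (commuting_graph H)"
      using x y V by (auto simp: commuting_graph_def)
    also have "\<dots> \<longleftrightarrow> (x, y) \<in> parcs (commuting_graph G)"
      unfolding A using inj x y
      by (auto simp: commuting_graph_def image_iff dest: inj_onD)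
    also have "\<dots> \<longleftrightarrow> x \<otimes>\<^bsub>G\<^esub> y = y \<otimes>\<^bsub>G\<^esub> x"
      using x y ne by (auto simp: commuting_graph_def)
    finally show ?thesis by blast
  qed
  then show ?R using inj V by (auto simp: bij_betw_def)
next
  assume ?R
  then obtain f where inj: "inj_on f (carrier G)" and V: "f ` carrier G = carrier H"
    and c: "\<And>x y. x \<in> carrier G \<Longrightarrow> y \<in> carrier G \<Longrightarrow> x \<noteq> y \<Longrightarrow>
      x \<otimes>\<^bsub>G\<^esub> y = y \<otimes>\<^bsub>G\<^esub> x \<longleftrightarrow> f x \<otimes>\<^bsub>H\<^esub> f y = f y \<otimes>\<^bsub>H\<^esub> f x"
    by (auto simp: bij_betw_def)
  let ?h = "\<lparr> iso_verts = f, iso_arcs = (\<lambda>e. (f (fst e), f (snd e))), iso_head = snd, iso_tail = fst \<rparr>"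
  have wf: "wf_digraph (with_proj (commuting_graph G))"
    by unfold_locales (auto simp: commuting_graph_def)
  have "pre_digraph.digraph_isomorphism (with_proj (commuting_graph G)) ?h"
    using wf inj
    by (auto simp: pre_digraph.digraph_isomorphism_def commuting_graph_def inj_on_def)
  moreover have "parcs (commuting_graph H) = (\<lambda>e. (f (fst e), f (snd e))) ` parcs (commuting_graph G)"
  proof (intro equalityI subsetI)
    fix e assume "e \<in> parcs (commuting_graph H)"
    then obtain u v where e: "e = (u, v)" "u \<in> carrier H" "v \<in> carrier H" "u \<noteq> v"
        "u \<otimes>\<^bsub>H\<^esub> v = v \<otimes>\<^bsub>H\<^esub> u"
      by (auto simp: commuting_graph_def)
    then obtain x y where "x \<in> carrier G" "y \<in> carrier G" "u = f x" "v = f y"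
      using V by blast
    with e c have "(x, y) \<in> parcs (commuting_graph G)" "e = (f x, f y)"
      by (auto simp: commuting_graph_def)
    then show "e \<in> (\<lambda>e. (f (fst e), f (snd e))) ` parcs (commuting_graph G)"
      by force
  next
    fix e assume "e \<in> (\<lambda>e. (f (fst e), f (snd e))) ` parcs (commuting_graph G)"
    then show "e \<in> parcs (commuting_graph H)"
      using inj V c by (auto simp: commuting_graph_def dest: inj_onD)
  qed
  then have "with_proj (commuting_graph H) = app_iso ?h (with_proj (commuting_graph G))"
    using V by (simp add: app_iso_def with_proj_def commuting_graph_def)
  ultimately show ?L unfolding digraph_iso_def by blast
qed

text \<open>The commutator map on pairs of cosets of the centre; it is well defined by
  \<open>commutator_map_coset\<close> below.\<close>

definition commutator_map :: "('a, 'b) monoid_scheme \<Rightarrow> 'a set \<Rightarrow> 'a set \<Rightarrow> 'a" where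
  "commutator_map G A B = (THE c. \<exists>a \<in> A. \<exists>b \<in> B. c = commutator G a b)"

lemma (in group) centre_normal: "centre G \<lhd> G"
proof -
  have i: "inv z \<otimes> x = x \<otimes> inv z"
    if "z \<in> carrier G" "x \<in> carrier G" "z \<otimes> x = x \<otimes> z" for z x
  proof -
    have "inv z \<otimes> x = inv z \<otimes> (x \<otimes> z) \<otimes> inv z"
      using that(1,2) by (simp add: m_assoc)
    also have "\<dots> = inv z \<otimes> (z \<otimes> x) \<otimes> inv z" by (simp only: that(3))
    also have "\<dots> = x \<otimes> inv z" using that(1,2) by (simp flip: m_assoc)
    finally show ?thesis .
  qed
  have "subgroup (centre G) G"
  proof (rule subgroupI)
    show "centre G \<noteq> {}" by (auto simp: centre_def intro!: exI[of _ \<one>])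
  next
    fix a b assume a: "a \<in> centre G" and b: "b \<in> centre G"
    then have c: "a \<in> carrier G" "b \<in> carrier G" by (auto simp: centre_def)
    have "a \<otimes> b \<otimes> x = x \<otimes> (a \<otimes> b)" if x: "x \<in> carrier G" for x
    proof -
      have "a \<otimes> b \<otimes> x = a \<otimes> x \<otimes> b" using b c x by (simp add: centre_def m_assoc)
      also have "a \<otimes> x = x \<otimes> a" using a x by (simp add: centre_def)
      also have "x \<otimes> a \<otimes> b = x \<otimes> (a \<otimes> b)" using c x by (simp add: m_assoc)
      finally show ?thesis .
    qed
    then show "a \<otimes> b \<in> centre G" using c by (simp add: centre_def)
  qed (auto simp: centre_def i)
  moreover have "x \<otimes> h \<otimes> inv x \<in> centre G" if "x \<in> carrier G" "h \<in> centre G" for x h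
  proof -
    have "x \<otimes> h \<otimes> inv x = h \<otimes> x \<otimes> inv x" and "h \<in> carrier G"
      using that by (auto simp: centre_def)
    then show ?thesis using that by (simp add: m_assoc)
  qed
  ultimately show ?thesis by (simp add: normal_inv_iff)
qed

lemma (in group) commutator_centre:
  assumes z: "z \<in> centre G" and w: "w \<in> centre G" and a: "a \<in> carrier G" and b: "b \<in> carrier G"
  shows "commutator G (z \<otimes> a) (w \<otimes> b) = commutator G a b"
proof -
  have zc: "z \<in> carrier G" "\<And>x. x \<in> carrier G \<Longrightarrow> x \<otimes> z = z \<otimes> x"
    and wc: "w \<in> carrier G" "\<And>x. x \<in> carrier G \<Longrightarrow> x \<otimes> w = w \<otimes> x"
    using z w by (auto simp: centre_def)
  have pull: "u \<otimes> x \<otimes> (v \<otimes> y) = x \<otimes> y \<otimes> (u \<otimes> v)"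
    if u: "u \<in> centre G" and v: "v \<in> centre G" and x: "x \<in> carrier G" and y: "y \<in> carrier G"
    for u v x y
  proof -
    have c: "u \<in> carrier G" "v \<in> carrier G" using u v by (auto simp: centre_def)
    have vy: "v \<otimes> y = y \<otimes> v" and vu: "v \<otimes> u = u \<otimes> v" using v c y by (simp_all add: centre_def)
    have "u \<otimes> x \<otimes> (v \<otimes> y) = u \<otimes> (x \<otimes> (y \<otimes> v))" unfolding vy using c x y by (simp add: m_assoc)
    also have "\<dots> = x \<otimes> (y \<otimes> v) \<otimes> u" using u c x y by (simp add: centre_def)
    also have "\<dots> = x \<otimes> y \<otimes> (v \<otimes> u)" using c x y by (simp add: m_assoc)
    also have "\<dots> = x \<otimes> y \<otimes> (u \<otimes> v)" unfolding vu ..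
    finally show ?thesis .
  qed
  have "z \<otimes> a \<otimes> (w \<otimes> b) = a \<otimes> b \<otimes> (z \<otimes> w)"
    using z w a b by (rule pull)
  moreover have "b \<otimes> a \<otimes> (z \<otimes> w) = w \<otimes> b \<otimes> (z \<otimes> a)"
    using pull[OF w z b a] wc(2)[OF zc(1)] by simp
  moreover have "commutator G x y = x \<otimes> y \<otimes> inv (y \<otimes> x)"
    if "x \<in> carrier G" "y \<in> carrier G" for x y
    using that by (simp add: commutator_def inv_mult_group m_assoc)
  moreover have "a \<otimes> b \<otimes> (z \<otimes> w) \<otimes> inv (b \<otimes> a \<otimes> (z \<otimes> w)) = a \<otimes> b \<otimes> inv (b \<otimes> a)"
  proof -
    have "a \<otimes> b \<otimes> (z \<otimes> w) \<otimes> inv (b \<otimes> a \<otimes> (z \<otimes> w)) =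
        a \<otimes> b \<otimes> ((z \<otimes> w) \<otimes> inv (z \<otimes> w)) \<otimes> inv (b \<otimes> a)"
      using zc(1) wc(1) a b by (simp only: inv_mult_group m_assoc m_closed inv_closed)
    then show ?thesis using zc(1) wc(1) a b by simp
  qed
  ultimately show ?thesis using zc(1) wc(1) a b by (metis m_closed)
qed

lemma (in group) commutator_map_coset:
  assumes "a \<in> carrier G" "b \<in> carrier G"
  shows "commutator_map G (centre G #> a) (centre G #> b) = commutator G a b"
  unfolding commutator_map_def
proof (rule the_equality)
  have "a \<in> centre G #> a" "b \<in> centre G #> b"
    using assms centre_normal by (auto intro!: rcos_self simp: normal_def)
  then show "\<exists>x \<in> centre G #> a. \<exists>y \<in> centre G #> b. commutator G a b = commutator G x y" by blast
qed (use assms in \<open>auto simp: r_coset_def commutator_centre\<close>)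

text \<open>\<open>derived G (carrier G)\<close> is the derived subgroup, regarded here as a group by restriction.\<close>

definition isoclinic :: "('a, 'c) monoid_scheme \<Rightarrow> ('b, 'd) monoid_scheme \<Rightarrow> bool" where
  "isoclinic G H \<longleftrightarrow>
     (\<exists>\<phi> \<in> iso (G Mod centre G) (H Mod centre H).
      \<exists>\<psi> \<in> iso (G\<lparr>carrier := derived G (carrier G)\<rparr>) (H\<lparr>carrier := derived H (carrier H)\<rparr>).
        \<forall>A \<in> carrier (G Mod centre G). \<forall>B \<in> carrier (G Mod centre G).
          \<psi> (commutator_map G A B) = commutator_map H (\<phi> A) (\<phi> B))"

end

theory Submission
  imports
    Defs
    "HOL-Library.Numeral_Type"
    "HOL-Library.Product_Plus"
    "HOL-Library.Countable"
begin

text \<open>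
  Let \<open>A\<close> be an abelian group, and let \<open>D\<close> be its generalised dihedral group: the semidirect product
  of \<open>A\<close> with a group of order \<open>2\<close> acting by inversion. Write \<open>A[2]\<close> for the subgroup of all
  \<open>a\<close> with \<open>2a = 0\<close>.

  The commuting graph of \<open>D\<close> sees very little of \<open>A\<close>. Rotations commute with each other, a rotation
  \<open>a\<close> commutes with a reflection iff \<open>a \<in> A[2]\<close>, and two reflections commute iff their parameters
  agree modulo \<open>A[2]\<close>. So a bijection between two abelian groups that carries the partition into
  cosets of the \<open>2\<close>-torsion to the corresponding partition, and the torsion itself to the torsion,
  induces an isomorphism of commuting graphs. Such a bijection exists as soon as the two groups have
  the same order and equally large \<open>2\<close>-torsion (\<open>digraph_iso_dihedral\<close>).

  On the other hand the lower central series of \<open>D\<close> is \<open>D\<close>, \<open>2A\<close>, \<open>4A\<close>, \<open>8A\<close>, and so on. Hence \<open>D\<close>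
  has class \<open>3\<close> when \<open>A\<close> has exponent \<open>8\<close> (\<open>dihedral_class_3\<close>), and the squares of the elements of its
  derived subgroup \<open>2A\<close> form \<open>4A\<close>. Isoclinic groups have isomorphic derived subgroups, so the number
  of these squares is an invariant of isoclinism (\<open>isoclinic_card_squares\<close>).

  It remains to find two abelian groups of exponent \<open>8\<close> with the same order and equally large
  \<open>2\<close>-torsion, but with \<open>4A\<close> of different orders. The groups \<open>C\<^sub>8 \<times> C\<^sub>8 \<times> C\<^sub>2\<close> and
  \<open>C\<^sub>8 \<times> C\<^sub>4 \<times> C\<^sub>4\<close> have order \<open>128\<close> and \<open>2\<close>-torsion of order \<open>8\<close>, while \<open>4A\<close> has order \<open>4\<close> in the
  first and \<open>2\<close> in the second.
\<close>

section \<open>Generalised dihedral groups\<close>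

text \<open>The type \<open>'a\<close> plays the part of the abelian group. The pair \<open>(a, s)\<close> stands for the rotation by
  \<open>a\<close> if \<open>s\<close> is false, and for that rotation times a fixed reflection if \<open>s\<close> is true; pairs are
  coded as natural numbers so that the groups obtained from different types have the same type.\<close>

definition elt :: "'a::{ab_group_add,finite} \<Rightarrow> bool \<Rightarrow> nat" where
  "elt a s = to_nat (a, s)"

definition dihedral :: "'a::{ab_group_add,finite} itself \<Rightarrow> nat monoid" where
  "dihedral _ = \<lparr> carrier = range (\<lambda>(a :: 'a, s). elt a s),
     monoid.mult = (\<lambda>x y. case (from_nat x :: 'a \<times> bool, from_nat y :: 'a \<times> bool) of
       ((a, s), (b, t)) \<Rightarrow> elt (if s then a - b else a + b) (s \<noteq> t)),
     monoid.one = elt (0 :: 'a) False \<rparr>"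

lemma elt_eq_iff [simp]: "elt a s = elt b t \<longleftrightarrow> a = b \<and> s = t"
  by (simp add: elt_def)

lemma from_nat_elt [simp]: "from_nat (elt a s) = (a, s)"
  by (simp add: elt_def)

lemma elt_carrier [simp]:
  "elt (a :: 'a::{ab_group_add,finite}) s \<in> carrier (dihedral TYPE('a))"
  by (auto simp: dihedral_def)

lemma dihedralE:
  assumes "x \<in> carrier (dihedral TYPE('a::{ab_group_add,finite}))"
  obtains a :: "'a::{ab_group_add,finite}" and s where "x = elt a s"
  using assms by (auto simp: dihedral_def)

lemma elt_mult [simp]:
  "elt (a :: 'a::{ab_group_add,finite}) s \<otimes>\<^bsub>dihedral TYPE('a)\<^esub> elt b t =
    elt (if s then a - b else a + b) (s \<noteq> t)"
  by (simp add: dihedral_def)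

lemma one_dihedral [simp]: "\<one>\<^bsub>dihedral TYPE('a::{ab_group_add,finite})\<^esub> = elt (0 :: 'a) False"
  by (simp add: dihedral_def)

lemma finite_dihedral: "finite (carrier (dihedral TYPE('a::{ab_group_add,finite})))"
  by (simp add: dihedral_def)

lemma group_dihedral: "group (dihedral TYPE('a::{ab_group_add,finite}))" (is "group ?D")
proof (rule groupI)
  fix x assume "x \<in> carrier ?D"
  then obtain a :: 'a and s where x: "x = elt a s" by (rule dihedralE)
  show "\<exists>y \<in> carrier ?D. y \<otimes>\<^bsub>?D\<^esub> x = \<one>\<^bsub>?D\<^esub>"
    by (rule bexI[of _ "elt (if s then a else - a) s"]) (simp_all add: x)
qed (auto elim!: dihedralE)

lemma inv_elt [simp]:
  "inv\<^bsub>dihedral TYPE('a)\<^esub> (elt (a :: 'a::{ab_group_add,finite}) s) = elt (if s then a else - a) s"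
  by (rule group.inv_equality[OF group_dihedral]) simp_all

section \<open>Commuting graphs\<close>

text \<open>Since a reflection inverts every rotation, it commutes exactly with those that are their own
  inverse; and two reflections differ by the rotation \<open>a - b\<close>, so they commute exactly if that rotation
  is its own inverse.\<close>

lemma elt_commute_iff:
  fixes a b :: "'a::{ab_group_add,finite}"
  shows "elt a s \<otimes>\<^bsub>dihedral TYPE('a)\<^esub> elt b t = elt b t \<otimes>\<^bsub>dihedral TYPE('a)\<^esub> elt a s \<longleftrightarrow>
    (if s then if t then a + a = b + b else b + b = 0 else if t then a + a = 0 else True)"
proof -
  have "a - b = b - a \<longleftrightarrow> a + a = b + b"
    by (metis add_diff_eq diff_add_eq diff_eq_eq)
  moreover have "x - y = y + x \<longleftrightarrow> y + y = 0" "y + x = x - y \<longleftrightarrow> y + y = 0" for x y :: 'a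
    by (auto simp: diff_eq_eq eq_diff_eq add.assoc add.left_commute)
  ultimately show ?thesis by (auto simp: add.commute)
qed

text \<open>Two maps with equally large domains all of whose fibres have the same size \<open>k\<close> have equally
  many fibres; so one may match the fibres first, pairing that of \<open>a\<close> with that of \<open>b\<close>, and then
  the points within matched fibres.\<close>

lemma fibrewise_bijection:
  fixes p :: "'a::finite \<Rightarrow> 'c" and q :: "'b::finite \<Rightarrow> 'd"
  assumes p: "\<And>x. card {x'. p x' = p x} = k" and q: "\<And>y. card {y'. q y' = q y} = k"
    and card: "CARD('a) = CARD('b)"
  obtains f where "bij f" "\<And>x x'. q (f x) = q (f x') \<longleftrightarrow> p x = p x'" "q (f a) = q b"
proof -
  have count: "CARD('e) = card (range r) * k" if "\<And>x. card {x'. r x' = r x} = k"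
    for r :: "'e::finite \<Rightarrow> 'f"
  proof -
    have "CARD('e) = (\<Sum>v\<in>range r. card {x. r x = v})"
      using sum.image_gen[of "UNIV :: 'e set" "\<lambda>_. 1 :: nat" r] by simp
    also have "\<dots> = (\<Sum>v\<in>range r. k)" by (rule sum.cong) (use that in auto)
    finally show ?thesis by simp
  qed
  have "card (range p) * k = card (range q) * k"
    unfolding count[of p, OF p, symmetric] count[of q, OF q, symmetric] by (rule card)
  moreover have "0 < card {x. p x = p a}" by (auto simp: card_gt_0_iff)
  then have "k \<noteq> 0" by (simp add: p)
  ultimately have "card (range p - {p a}) = card (range q - {q b})" by simp
  then have "\<exists>g0. bij_betw g0 (range p - {p a}) (range q - {q b})"
    by (intro finite_same_card_bij) simp_all
  then obtain g0 where "bij_betw g0 (range p - {p a}) (range q - {q b})" ..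
  define g where "g = g0(p a := q b)"
  have "bij_betw g (range p - {p a}) (range q - {q b})"
    using \<open>bij_betw g0 _ _\<close> bij_betw_cong[of "range p - {p a}" g g0] by (simp add: g_def)
  then have "bij_betw g ((range p - {p a}) \<union> {p a}) ((range q - {q b}) \<union> {g (p a)})"
    by (intro notIn_Un_bij_betw) (auto simp: g_def)
  moreover have gpa: "g (p a) = q b" by (simp add: g_def)
  ultimately have g: "bij_betw g (range p) (range q)"
    by (simp add: insert_absorb)
  have "\<exists>h. bij_betw h {x. p x = v} {y. q y = g v}" if v: "v \<in> range p" for v
  proof (rule finite_same_card_bij)
    obtain x where x: "v = p x" using v by blast
    have "g v \<in> range q" using g v by (auto simp: bij_betw_def)
    then obtain y where "g v = q y" by auto
    then show "card {x. p x = v} = card {y. q y = g v}" using p q x by simp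
  qed auto
  then have "\<forall>v\<in>range p. \<exists>h. bij_betw h {x. p x = v} {y. q y = g v}" by blast
  from bchoice[OF this] obtain h
    where h: "bij_betw (h v) {x. p x = v} {y. q y = g v}" if "v \<in> range p" for v
    by blast
  define f where "f x = h (p x) x" for x
  have qf: "q (f x) = g (p x)" for x
    using bij_betwE[OF h[of "p x"]] by (auto simp: f_def)
  have iff: "q (f x) = q (f x') \<longleftrightarrow> p x = p x'" for x x'
    unfolding qf using g by (intro inj_on_eq_iff[of g "range p"]) (simp_all add: bij_betw_def)
  have "inj f"
  proof (rule injI)
    fix x x' assume eq: "f x = f x'"
    then have same: "p x' = p x" using iff[of x' x] by simp
    have "inj_on (h (p x)) {z. p z = p x}" using h[of "p x"] by (simp add: bij_betw_def)
    then show "x = x'" by (rule inj_onD) (use eq same in \<open>simp_all add: f_def\<close>)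
  qed
  moreover have "surj f"
  proof -
    have "card (range f) = CARD('b)" using card_image[OF \<open>inj f\<close>] card by simp
    then show ?thesis by (simp add: card_subset_eq)
  qed
  ultimately have "bij f" by (simp add: bij_def)
  moreover have "q (f a) = q b" by (simp add: qf gpa)
  ultimately show ?thesis using iff by (intro that)
qed

text \<open>The fibres of doubling are the cosets of the \<open>2\<close>-torsion.\<close>

lemma card_doubling_fibre:
  fixes a :: "'a::ab_group_add"
  shows "card {x. x + x = a + a} = card {x :: 'a. x + x = 0}"
proof (rule bij_betw_same_card[symmetric])
  have fwd: "(x + a) + (x + a) = a + a \<longleftrightarrow> x + x = 0" for x
  proof -
    have "(x + a) + (x + a) = (x + x) + (a + a)" by (simp only: ac_simps)
    then show ?thesis by simp
  qed
  have bwd: "(x - a) + (x - a) = 0 \<longleftrightarrow> x + x = a + a" for x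
    using fwd[of "x - a"] by simp
  show "bij_betw (\<lambda>x. x + a) {x. x + x = 0} {x. x + x = a + a}"
    by (rule bij_betw_byWitness[where f' = "\<lambda>x. x - a"]) (simp_all add: fwd bwd image_subset_iff)
qed

lemma digraph_iso_dihedral:
  assumes card: "CARD('a::{ab_group_add,finite}) = CARD('b::{ab_group_add,finite})"
    and torsion: "card {x :: 'a. x + x = 0} = card {x :: 'b. x + x = 0}"
  shows "digraph_iso (with_proj (commuting_graph (dihedral TYPE('a))))
    (with_proj (commuting_graph (dihedral TYPE('b))))"
    (is "digraph_iso (with_proj (commuting_graph ?D)) (with_proj (commuting_graph ?E))")
proof -
  have "card {x' :: 'b. x' + x' = x + x} = card {x :: 'a. x + x = 0}" for x
    by (simp only: card_doubling_fibre torsion)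
  from fibrewise_bijection[of "\<lambda>x :: 'a. x + x" _ "\<lambda>x :: 'b. x + x" 0 0,
      OF card_doubling_fibre this card]
  obtain f :: "'a \<Rightarrow> 'b" where f: "bij f"
    and dbl: "\<And>x y. f x + f x = f y + f y \<longleftrightarrow> x + x = y + y" and f0: "f 0 + f 0 = 0 + 0"
    by blast
  \<comment> \<open>Matching the fibres over \<open>0\<close> makes the torsion, not just its cosets, correspond.\<close>
  have zero: "f x + f x = 0 \<longleftrightarrow> x + x = 0" for x
    using dbl[of x 0] unfolding f0 by simp
  define F where "F x = (case from_nat x of (a :: 'a, s) \<Rightarrow> elt (f a) s)" for x
  have F: "F (elt a s) = elt (f a) s" for a s by (simp add: F_def)
  have "bij_betw F (carrier ?D) (carrier ?E)"
  proof (rule bij_betw_imageI)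
    show "inj_on F (carrier ?D)"
      using bij_is_inj[OF f] by (auto intro!: inj_onI elim!: dihedralE simp: F dest: injD)
    show "F ` carrier ?D = carrier ?E"
    proof (intro equalityI subsetI)
      fix y assume "y \<in> carrier ?E"
      then obtain b :: 'b and s where "y = elt b s" by (rule dihedralE)
      moreover obtain a where "b = f a" using bij_is_surj[OF f] by (auto elim: surjE)
      ultimately have "y = F (elt a s)" by (simp add: F)
      then show "y \<in> F ` carrier ?D" by simp
    qed (auto elim!: dihedralE simp: F)
  qed
  moreover have "x \<otimes>\<^bsub>?D\<^esub> y = y \<otimes>\<^bsub>?D\<^esub> x \<longleftrightarrow> F x \<otimes>\<^bsub>?E\<^esub> F y = F y \<otimes>\<^bsub>?E\<^esub> F x"
    if "x \<in> carrier ?D" "y \<in> carrier ?D" for x y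
    using that by (elim dihedralE) (simp add: F elt_commute_iff dbl zero del: elt_mult)
  ultimately show ?thesis
    unfolding digraph_iso_commuting_graph_iff by (intro exI[of _ F]) simp
qed

section \<open>The lower central series\<close>

lemma commutator_elt:
  fixes a b :: "'a::{ab_group_add,finite}"
  shows "commutator (dihedral TYPE('a)) (elt a s) (elt b t) =
    elt (if s then if t then (a - b) + (a - b) else - (b + b) else if t then a + a else 0) False"
  by (auto simp: commutator_def algebra_simps)

text \<open>Here \<open>m\<close> is going to be multiplication by a power of \<open>2\<close>. Keeping the map and not only its image
  lets one step of the lower central series be computed by replacing \<open>m a\<close> with \<open>m (a + a)\<close>.\<close>

definition rotations :: "('a::{ab_group_add,finite} \<Rightarrow> 'a) \<Rightarrow> nat set" where
  "rotations m = range (\<lambda>a. elt (m a) False)"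

lemma subgroup_rotations:
  fixes m :: "'a::{ab_group_add,finite} \<Rightarrow> 'a"
  assumes "additive m"
  shows "subgroup (rotations m) (dihedral TYPE('a))"
proof -
  interpret additive m by fact
  show ?thesis
  proof (rule group.subgroupI[OF group_dihedral])
    fix x assume "x \<in> rotations m"
    then obtain a where "x = elt (m a) False" by (auto simp: rotations_def)
    then have "inv\<^bsub>dihedral TYPE('a)\<^esub> x = elt (m (- a)) False" by (simp add: minus)
    then show "inv\<^bsub>dihedral TYPE('a)\<^esub> x \<in> rotations m" by (auto simp: rotations_def)
  next
    fix x y assume "x \<in> rotations m" "y \<in> rotations m"
    then obtain a b where "x = elt (m a) False" "y = elt (m b) False"
      by (auto simp: rotations_def)
    then have "x \<otimes>\<^bsub>dihedral TYPE('a)\<^esub> y = elt (m (a + b)) False" by (simp add: add)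
    then show "x \<otimes>\<^bsub>dihedral TYPE('a)\<^esub> y \<in> rotations m" by (auto simp: rotations_def)
  qed (auto simp: rotations_def)
qed

lemma generate_subgroup:
  assumes "group G" "subgroup H G"
  shows "generate G H = H"
  using group.generate_subgroup_incl[OF assms(1) subset_refl assms(2)] by (auto intro: generate.incl)

text \<open>Every commutator is the double of a rotation: a rotation \<open>a\<close> and a reflection give \<open>2a\<close> or its
  inverse, and two reflections give twice the difference of their parameters. All doubles occur
  already as commutators with the fixed reflection, so the commutators themselves form a subgroup.\<close>

lemma lower_central_series_1_dihedral:
  "lower_central_series (dihedral TYPE('a::{ab_group_add,finite})) 1 = rotations (\<lambda>a :: 'a. a + a)"
  (is "lower_central_series ?D 1 = ?R")
proof -
  have "{commutator ?D x y | x y. x \<in> carrier ?D \<and> y \<in> carrier ?D} = ?R"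
  proof (intro equalityI subsetI)
    fix z assume "z \<in> {commutator ?D x y | x y. x \<in> carrier ?D \<and> y \<in> carrier ?D}"
    then obtain a b :: 'a and s t where "z = commutator ?D (elt a s) (elt b t)"
      by (auto elim!: dihedralE)
    then have "z = elt ((if s then if t then a - b else - b else if t then a else 0) +
        (if s then if t then a - b else - b else if t then a else 0)) False"
      by (simp add: commutator_elt)
    then show "z \<in> ?R" unfolding rotations_def by blast
  next
    fix z assume "z \<in> ?R"
    then obtain a :: 'a where "z = elt (a + a) False" by (auto simp: rotations_def)
    then have "z = commutator ?D (elt a False) (elt (0 :: 'a) True)" by (simp add: commutator_elt)
    then show "z \<in> {commutator ?D x y | x y. x \<in> carrier ?D \<and> y \<in> carrier ?D}"
      using elt_carrier by blast
  qed
  moreover have "additive (\<lambda>a :: 'a. a + a)" by unfold_locales (simp add: ac_simps)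
  ultimately show ?thesis
    by (simp add: generate_subgroup[OF group_dihedral subgroup_rotations])
qed

text \<open>A rotation commutes with all rotations, and its commutator with any reflection is its double. So
  passing to the next term of the series amounts to doubling.\<close>

lemma lower_central_series_Suc_dihedral:
  fixes m :: "'a::{ab_group_add,finite} \<Rightarrow> 'a"
  assumes m: "additive m" and n: "lower_central_series (dihedral TYPE('a)) n = rotations m"
  shows "lower_central_series (dihedral TYPE('a)) (Suc n) = rotations (\<lambda>a. m (a + a))"
    (is "lower_central_series ?D _ = ?R")
proof -
  interpret additive m by fact
  have "{commutator ?D x y | x y. x \<in> rotations m \<and> y \<in> carrier ?D} = ?R"
  proof (intro equalityI subsetI)
    fix z assume "z \<in> {commutator ?D x y | x y. x \<in> rotations m \<and> y \<in> carrier ?D}"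
    then obtain a b :: 'a and t where "z = commutator ?D (elt (m a) False) (elt b t)"
      by (auto simp: rotations_def elim!: dihedralE)
    then have "z = elt (m ((if t then a else 0) + (if t then a else 0))) False"
      by (simp add: commutator_elt add zero)
    then show "z \<in> ?R" unfolding rotations_def by blast
  next
    fix z assume "z \<in> ?R"
    then obtain a :: 'a where "z = elt (m (a + a)) False" by (auto simp: rotations_def)
    then have "z = commutator ?D (elt (m a) False) (elt (0 :: 'a) True)"
      by (simp add: commutator_elt add)
    moreover have "elt (m a) False \<in> rotations m" by (simp add: rotations_def)
    ultimately show "z \<in> {commutator ?D x y | x y. x \<in> rotations m \<and> y \<in> carrier ?D}"
      using elt_carrier by blast
  qed
  moreover have "additive (\<lambda>a :: 'a. m (a + a))" by unfold_locales (simp add: add ac_simps)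
  ultimately show ?thesis
    by (simp add: n generate_subgroup[OF group_dihedral subgroup_rotations])
qed

lemma dihedral_class_3:
  fixes a :: "'a::{ab_group_add,finite}"
  assumes ex8: "\<And>a :: 'a. (a + a + (a + a)) + (a + a + (a + a)) = 0"
    and ex4: "a + a + (a + a) \<noteq> 0"
  shows "nilpotent_group (dihedral TYPE('a)) \<and> nilpotency_class (dihedral TYPE('a)) = 3"
proof -
  let ?D = "dihedral TYPE('a)"
  have add1: "additive (\<lambda>a :: 'a. a + a)" by unfold_locales (simp add: ac_simps)
  have add2: "additive (\<lambda>a :: 'a. a + a + (a + a))" by unfold_locales (simp add: ac_simps)
  have L1: "lower_central_series ?D 1 = rotations (\<lambda>a :: 'a. a + a)"
    by (rule lower_central_series_1_dihedral)
  have L2: "lower_central_series ?D 2 = rotations (\<lambda>a :: 'a. a + a + (a + a))"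
    using lower_central_series_Suc_dihedral[OF add1 L1] by (simp only: Suc_1)
  have "lower_central_series ?D 3 =
      rotations (\<lambda>a :: 'a. a + a + (a + a) + (a + a + (a + a)))"
    using lower_central_series_Suc_dihedral[OF add2 L2] by (simp only: eval_nat_numeral)
  then have L3: "lower_central_series ?D 3 = {\<one>\<^bsub>?D\<^esub>}"
    by (simp only: ex8) (simp add: rotations_def)
  have "a + a \<noteq> 0" using ex4 by auto
  have "lower_central_series ?D n \<noteq> {\<one>\<^bsub>?D\<^esub>}" if n: "n < 3" for n
  proof -
    consider "n = 0" | "n = 1" | "n = 2" using n by linarith
    then show ?thesis
    proof cases
      case 1
      have "elt (0 :: 'a) True \<in> lower_central_series ?D 0" by simp
      then show ?thesis using 1 by (auto simp del: lower_central_series.simps)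
    next
      case 2
      have "elt (a + a) False \<in> lower_central_series ?D 1" unfolding L1 by (simp add: rotations_def)
      then show ?thesis using 2 \<open>a + a \<noteq> 0\<close> by (auto simp del: lower_central_series.simps)
    next
      case 3
      have "elt (a + a + (a + a)) False \<in> lower_central_series ?D 2"
        unfolding L2 rotations_def by blast
      then show ?thesis using 3 ex4 by (auto simp del: lower_central_series.simps)
    qed
  qed
  then have "nilpotency_class ?D = 3"
    unfolding nilpotency_class_def by (intro Least_equality L3) (meson not_less)
  then show ?thesis
    using L3 group_dihedral by (auto simp: nilpotent_group_def)
qed

section \<open>An invariant of isoclinism\<close>

definition derived_squares :: "('a, 'b) monoid_scheme \<Rightarrow> 'a set" where
  "derived_squares G = (\<lambda>x. x \<otimes>\<^bsub>G\<^esub> x) ` derived G (carrier G)"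

text \<open>The isomorphism between the derived subgroups carries squares to squares.\<close>

lemma isoclinic_card_squares:
  assumes "isoclinic G H"
  shows "card (derived_squares G) = card (derived_squares H)"
proof -
  let ?G = "derived G (carrier G)" and ?H = "derived H (carrier H)"
  from assms obtain \<psi> where "\<psi> \<in> iso (G\<lparr>carrier := ?G\<rparr>) (H\<lparr>carrier := ?H\<rparr>)"
    by (auto simp: isoclinic_def)
  then have bij: "bij_betw \<psi> ?G ?H"
    and hom: "\<And>x y. x \<in> ?G \<Longrightarrow> y \<in> ?G \<Longrightarrow> \<psi> (x \<otimes>\<^bsub>G\<^esub> y) = \<psi> x \<otimes>\<^bsub>H\<^esub> \<psi> y"
    by (auto simp: iso_def hom_def)
  have "\<psi> ` derived_squares G = (\<lambda>x. \<psi> x \<otimes>\<^bsub>H\<^esub> \<psi> x) ` ?G"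
    unfolding derived_squares_def image_image by (rule image_cong) (simp_all add: hom)
  also have "\<dots> = (\<lambda>x. x \<otimes>\<^bsub>H\<^esub> x) ` \<psi> ` ?G" by (simp add: image_image)
  also have "\<psi> ` ?G = ?H" using bij by (simp add: bij_betw_def)
  finally have "\<psi> ` derived_squares G = derived_squares H" by (simp add: derived_squares_def)
  moreover have "derived_squares G \<subseteq> ?G"
    by (auto simp: derived_squares_def derived_def intro: generate.eng)
  then have "inj_on \<psi> (derived_squares G)"
    using bij by (auto simp: bij_betw_def intro: inj_on_subset)
  ultimately show ?thesis by (metis card_image)
qed

lemma card_derived_squares_dihedral:
  "card (derived_squares (dihedral TYPE('a::{ab_group_add,finite}))) =
    card (range (\<lambda>a :: 'a. a + a + (a + a)))"
proof -
  let ?D = "dihedral TYPE('a)"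
  have "derived ?D (carrier ?D) = lower_central_series ?D 1"
    unfolding derived_def One_nat_def lower_central_series.simps
    by (rule arg_cong[where f = "generate ?D"]) (auto simp: commutator_def)
  then have "derived_squares ?D = (\<lambda>a. elt a False) ` range (\<lambda>a :: 'a. a + a + (a + a))"
    unfolding lower_central_series_1_dihedral derived_squares_def
    by (simp add: rotations_def image_image)
  then show ?thesis by (simp add: card_image inj_on_def)
qed

section \<open>Two abelian groups of order 128\<close>

lemma UNIV_mod_2: "(UNIV :: 2 set) = {0, 1}"
proof -
  have "x \<in> {0, 1}" for x :: 2
  proof (cases x)
    case (of_int z)
    then have "0 \<le> z" "z < 2" by simp_all
    then have "z \<in> {0, 1}" unfolding insert_iff empty_iff by presburger
    then show ?thesis unfolding of_int(1) by auto
  qed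
  then show ?thesis by blast
qed

lemma UNIV_mod_4: "(UNIV :: 4 set) = {0, 1, 2, 3}"
proof -
  have "x \<in> {0, 1, 2, 3}" for x :: 4
  proof (cases x)
    case (of_int z)
    then have "0 \<le> z" "z < 4" by simp_all
    then have "z \<in> {0, 1, 2, 3}" unfolding insert_iff empty_iff by presburger
    then show ?thesis unfolding of_int(1) by auto
  qed
  then show ?thesis by blast
qed

lemma UNIV_mod_8: "(UNIV :: 8 set) = {0, 1, 2, 3, 4, 5, 6, 7}"
proof -
  have "x \<in> {0, 1, 2, 3, 4, 5, 6, 7}" for x :: 8
  proof (cases x)
    case (of_int z)
    then have "0 \<le> z" "z < 8" by simp_all
    then have "z \<in> {0, 1, 2, 3, 4, 5, 6, 7}" unfolding insert_iff empty_iff by presburger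
    then show ?thesis unfolding of_int(1) by auto
  qed
  then show ?thesis by blast
qed

lemma torsion_2: "{x :: 2. x + x = 0} = {0, 1}"
proof -
  have "{x :: 2. x + x = 0} = {x \<in> {0, 1}. x + x = 0}" unfolding UNIV_mod_2[symmetric] by simp
  also have "\<dots> = {0, 1}" by auto
  finally show ?thesis .
qed

lemma torsion_4: "{x :: 4. x + x = 0} = {0, 2}"
proof -
  have "{x :: 4. x + x = 0} = {x \<in> {0, 1, 2, 3}. x + x = 0}"
    unfolding UNIV_mod_4[symmetric] by simp
  also have "\<dots> = {0, 2}" by auto
  finally show ?thesis .
qed

lemma torsion_8: "{x :: 8. x + x = 0} = {0, 4}"
proof -
  have "{x :: 8. x + x = 0} = {x \<in> {0, 1, 2, 3, 4, 5, 6, 7}. x + x = 0}"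
    unfolding UNIV_mod_8[symmetric] by simp
  also have "\<dots> = {0, 4}" by auto
  finally show ?thesis .
qed

lemma torsion_prod:
  "{x :: 'a::ab_group_add \<times> 'b::ab_group_add. x + x = 0} = {x. x + x = 0} \<times> {x. x + x = 0}"
  by (auto simp: zero_prod_def)

lemma quadruple_prod:
  "range (\<lambda>x :: 'a::ab_group_add \<times> 'b::ab_group_add. x + x + (x + x)) =
    range (\<lambda>x. x + x + (x + x)) \<times> range (\<lambda>x. x + x + (x + x))"
  by (auto simp: image_iff)

lemma quadruple_2: "range (\<lambda>x :: 2. x + x + (x + x)) = {0}"
  unfolding UNIV_mod_2 by simp

lemma quadruple_4: "range (\<lambda>x :: 4. x + x + (x + x)) = {0}"
  unfolding UNIV_mod_4 by simp

lemma quadruple_8: "range (\<lambda>x :: 8. x + x + (x + x)) = {0, 4}"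
  unfolding UNIV_mod_8 by auto

lemma eight_times_eq_0: "8 * a = 0" "8 * b = 0" "8 * c = 0" for a :: 2 and b :: 4 and c :: 8
proof -
  have "(8 :: 2) = 0" "(8 :: 4) = 0" "(8 :: 8) = 0" by simp_all
  then show "8 * a = 0" "8 * b = 0" "8 * c = 0" by (simp_all only: mult_zero_left)
qed

theorem mainTheorem5:
  shows "\<exists>(G :: nat monoid) (H :: nat monoid).
    finite (carrier G) \<and> nilpotent_group G \<and> nilpotency_class G = 3 \<and>
    finite (carrier H) \<and> nilpotent_group H \<and> nilpotency_class H = 3 \<and>
    digraph_iso (with_proj (commuting_graph G)) (with_proj (commuting_graph H)) \<and>
    \<not> isoclinic G H"
proof (intro exI conjI)
  let ?G = "dihedral TYPE(8 \<times> 8 \<times> 2)" and ?H = "dihedral TYPE(8 \<times> 4 \<times> 4)"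
  have G: "nilpotent_group ?G \<and> nilpotency_class ?G = 3"
    by (rule dihedral_class_3[where a = "(1, 0, 0)"])
      (auto simp: eight_times_eq_0 zero_prod_def)
  then show "nilpotent_group ?G" "nilpotency_class ?G = 3" by simp_all
  have H: "nilpotent_group ?H \<and> nilpotency_class ?H = 3"
    by (rule dihedral_class_3[where a = "(1, 0, 0)"])
      (auto simp: eight_times_eq_0 zero_prod_def)
  then show "nilpotent_group ?H" "nilpotency_class ?H = 3" by simp_all
  show "finite (carrier ?G)" "finite (carrier ?H)" by (rule finite_dihedral)+
  show "digraph_iso (with_proj (commuting_graph ?G)) (with_proj (commuting_graph ?H))"
  proof (rule digraph_iso_dihedral)
    show "card {x :: 8 \<times> 8 \<times> 2. x + x = 0} = card {x :: 8 \<times> 4 \<times> 4. x + x = 0}"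
      unfolding torsion_prod torsion_2 torsion_4 torsion_8 card_cartesian_product by simp
  qed simp
  have "card (derived_squares ?G) = 4" "card (derived_squares ?H) = 2"
    unfolding card_derived_squares_dihedral quadruple_prod quadruple_2 quadruple_4 quadruple_8
      card_cartesian_product by simp_all
  then show "\<not> isoclinic ?G ?H" using isoclinic_card_squares by fastforce
qed

end
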